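(* Suppose the adjacency matrix $A$ on $n$ nodes is generated from the $K$-block stochastic block model with true parameter $\theta^*\in\Theta_K$, as described in the context, and let $K^+>K$ be a fixed integer. Assume that there is an $\epsilon>0$, not depending on $n$, such that, with probability tending to one, the maximum over $z\in\mathcal V_{K^+}$ of $\sup_{\theta\in\Theta_{K^+}}\log f(z,A;\theta)$ is attained at some element of $$\mathcal N_{K^+}=\{z\in\mathcal V_{K^+}: n_k(z)\ge\epsilon n\text{ for all }k\in[K^+]\}.$$ Then, as $n\to\infty$, $L_{K,K^+}=O_P(n)$.
   Context: Model. $[K]=\{1,\dots,K\}$, with $K$ fixed as $n\to\infty$. For $K'\ge1$, $\Theta_{K'}$ is the set of $\theta=(\pi,H)$ with $\pi\in(0,1)^{K'}$, $\sum_a\pi_a=1$ (for $K'=1$, $\pi=1$), and $H\in(0,1)^{K'\times K'}$ symmetric. Under $\theta^*=(\pi^*,H^* )\in\Theta_K$, the latent labels $Z=(Z_1,\dots,Z_n)\in[K]^n$ are i.i.d. with $P(Z_i=a)=\pi_a^*$; given $Z$, $A$ is a symmetric $0/1$ matrix with zero diagonal whose entries $A_{i,j}$, $i<j$, are independent Bernoulli$(H^*_{Z_i,Z_j})$. Write $H^*=\rho_nS^*$, where $\pi^*$ and the symmetric matrix $S^*$ with positive entries do not depend on $n$, and $H^*$ has no two identical columns. The degree density $\rho_n$ satisfies either $\rho_n=\Omega(1)$, or $\rho_n\to0$ with $n\rho_n/\log n\to\infty$. Likelihood. For $z\in[K']^n$ let $n_a(z)=\sum_i\mathbf 1(z_i=a)$,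 $n_{a,b}(z)=\sum_i\sum_{j\ne i}\mathbf 1(z_i=a,z_j=b)$, $O_{a,b}(z)=\sum_i\sum_{j\ne i}\mathbf 1(z_i=a,z_j=b)A_{i,j}$. For $\theta\in\Theta_{K'}$, $$f(z,A;\theta)=\Big(\prod_{a=1}^{K'}\pi_a^{n_a(z)}\Big)\Big(\prod_{a,b=1}^{K'}H_{a,b}^{O_{a,b}(z)}(1-H_{a,b})^{n_{a,b}(z)-O_{a,b}(z)}\Big)^{1/2},\qquad g(A;\theta)=\sum_{z\in[K']^n}f(z,A;\theta),$$ and the log likelihood ratio is $L_{K,K'}=\log\dfrac{\sup_{\theta\in\Theta_{K'}}g(A;\theta)}{\sup_{\theta\in\Theta_K}g(A;\theta)}$. $O_P$ is with respect to the law of $A$ under $\theta^*$. Splittings. For $z\in[K^+]^n$, $R(z,Z)$ is the $K^+\times K$ confusion matrix with entries $R_{k,a}(z,Z)=n^{-1}\sum_{i=1}^n\mathbf 1(z_i=k,Z_i=a)$, and $$\mathcal V_{K^+}=\{z\in[K^+]^n:\text{every row of }R(z,Z)\text{ has at most one nonzero entry}\}.$$ *)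

theory Defs
  imports "HOL-Probability.Probability" "HOL-Library.Landau_Symbols"
begin

text \<open>
  Nodes are \<open>1, \<dots>, n\<close>, block labels are \<open>1, \<dots>, K\<close>. Label vectors in \<open>[K]^n\<close> are the extensional
  functions in \<open>labelings n K\<close>. A parameter \<open>(\<pi>, H)\<close> is a pair of functions of which only the
  values on \<open>{1..K}\<close> matter.
\<close>

type_synonym labeling = "nat \<Rightarrow> nat"
type_synonym adjacency = "nat \<Rightarrow> nat \<Rightarrow> nat"
type_synonym param = "(nat \<Rightarrow> real) \<times> (nat \<Rightarrow> nat \<Rightarrow> real)"

definition labelings :: "nat \<Rightarrow> nat \<Rightarrow> labeling set" where
  "labelings n K = {1..n} \<rightarrow>\<^sub>E {1..K}"

text \<open>For \<open>K = 1\<close> the only admissible \<open>\<pi>\<close> is the constant 1, hence the guard on \<open>\<pi> a < 1\<close>.\<close>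

definition params :: "nat \<Rightarrow> param set" where
  "params K = {(\<pi>, H).
     (\<forall>a\<in>{1..K}. 0 < \<pi> a \<and> (K \<noteq> 1 \<longrightarrow> \<pi> a < 1)) \<and> (\<Sum>a=1..K. \<pi> a) = 1 \<and>
     (\<forall>a\<in>{1..K}. \<forall>b\<in>{1..K}. 0 < H a b \<and> H a b < 1 \<and> H a b = H b a)}"

definition label_pmf :: "nat \<Rightarrow> (nat \<Rightarrow> real) \<Rightarrow> nat pmf" where
  "label_pmf K \<pi> = embed_pmf (\<lambda>a. if a \<in> {1..K} then \<pi> a else 0)"

text \<open>
  Joint law of the latent labels and the adjacency matrix. The independent edge indicators live on
  the pairs \<open>i < j\<close>; since they are \<open>False\<close> off these pairs, the reflected matrix has zero diagonal.
\<close>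

definition sbm :: "nat \<Rightarrow> nat \<Rightarrow> param \<Rightarrow> (labeling \<times> adjacency) pmf" where
  "sbm n K = (\<lambda>(\<pi>, H).
     do {
       Z \<leftarrow> Pi_pmf {1..n} undefined (\<lambda>_. label_pmf K \<pi>);
       e \<leftarrow> Pi_pmf {(i, j). 1 \<le> i \<and> i < j \<and> j \<le> n} False
              (\<lambda>(i, j). bernoulli_pmf (H (Z i) (Z j)));
       return_pmf (Z, \<lambda>i j. of_bool (e (min i j, max i j)))
     })"

definition block_size :: "nat \<Rightarrow> labeling \<Rightarrow> nat \<Rightarrow> nat" where
  "block_size n z a = (\<Sum>i=1..n. of_bool (z i = a))"

definition pair_count :: "nat \<Rightarrow> labeling \<Rightarrow> nat \<Rightarrow> nat \<Rightarrow> nat" where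
  "pair_count n z a b = (\<Sum>i=1..n. \<Sum>j\<in>{1..n} - {i}. of_bool (z i = a \<and> z j = b))"

definition edge_count :: "nat \<Rightarrow> labeling \<Rightarrow> adjacency \<Rightarrow> nat \<Rightarrow> nat \<Rightarrow> nat" where
  "edge_count n z A a b = (\<Sum>i=1..n. \<Sum>j\<in>{1..n} - {i}. of_bool (z i = a \<and> z j = b) * A i j)"

text \<open>
  The natural-number subtraction does not truncate when the entries of \<open>A\<close> are 0 or 1.
\<close>

definition complete_lik :: "nat \<Rightarrow> nat \<Rightarrow> labeling \<Rightarrow> adjacency \<Rightarrow> param \<Rightarrow> real" where
  "complete_lik n K z A = (\<lambda>(\<pi>, H).
     (\<Prod>a=1..K. \<pi> a ^ block_size n z a) *
     sqrt (\<Prod>a=1..K. \<Prod>b=1..K.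
       H a b ^ edge_count n z A a b * (1 - H a b) ^ (pair_count n z a b - edge_count n z A a b)))"

definition marginal_lik :: "nat \<Rightarrow> nat \<Rightarrow> adjacency \<Rightarrow> param \<Rightarrow> real" where
  "marginal_lik n K A \<theta> = (\<Sum>z\<in>labelings n K. complete_lik n K z A \<theta>)"

definition log_lik_ratio :: "nat \<Rightarrow> nat \<Rightarrow> nat \<Rightarrow> adjacency \<Rightarrow> real" where
  "log_lik_ratio n K K' A =
     ln ((SUP \<theta>\<in>params K'. marginal_lik n K' A \<theta>) / (SUP \<theta>\<in>params K. marginal_lik n K A \<theta>))"

definition max_log_complete_lik :: "nat \<Rightarrow> nat \<Rightarrow> labeling \<Rightarrow> adjacency \<Rightarrow> real" where
  "max_log_complete_lik n K z A = (SUP \<theta>\<in>params K. ln (complete_lik n K z A \<theta>))"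

definition confusion :: "nat \<Rightarrow> labeling \<Rightarrow> labeling \<Rightarrow> nat \<Rightarrow> nat \<Rightarrow> real" where
  "confusion n z Z k a = (\<Sum>i=1..n. of_bool (z i = k \<and> Z i = a)) / real n"

definition splittings :: "nat \<Rightarrow> nat \<Rightarrow> nat \<Rightarrow> labeling \<Rightarrow> labeling set" where
  "splittings n K K' Z = {z \<in> labelings n K'.
     \<forall>k\<in>{1..K'}. \<forall>a\<in>{1..K}. \<forall>b\<in>{1..K}.
       confusion n z Z k a \<noteq> 0 \<and> confusion n z Z k b \<noteq> 0 \<longrightarrow> a = b}"

definition large_splittings :: "real \<Rightarrow> nat \<Rightarrow> nat \<Rightarrow> nat \<Rightarrow> labeling \<Rightarrow> labeling set" where
  "large_splittings \<epsilon> n K K' Z =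
     {z \<in> splittings n K K' Z. \<forall>k\<in>{1..K'}. real (block_size n z k) \<ge> \<epsilon> * real n}"

definition bounded_in_prob ::
    "(nat \<Rightarrow> 'a pmf) \<Rightarrow> (nat \<Rightarrow> 'a \<Rightarrow> real) \<Rightarrow> (nat \<Rightarrow> real) \<Rightarrow> bool" where
  "bounded_in_prob P X r \<longleftrightarrow>
     (\<forall>\<delta>>0. \<exists>C>0. \<forall>\<^sub>F n in sequentially.
        measure_pmf.prob (P n) {x. \<bar>X n x\<bar> > C * r n} < \<delta>)"

text \<open>
  The following facts confirm that \<open>embed_pmf\<close> above, the suprema and the logarithms never take
  junk values.
\<close>

lemma pmf_label_pmf:
  assumes "(\<pi>, H) \<in> params K"
  shows "pmf (label_pmf K \<pi>) a = (if a \<in> {1..K} then \<pi> a else 0)"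
  unfolding label_pmf_def
proof (rule pmf_embed_pmf)
  show "0 \<le> (if x \<in> {1..K} then \<pi> x else 0)" for x
    using assms by (auto simp: params_def intro: less_imp_le)
  have "(\<integral>\<^sup>+ x. ennreal (if x \<in> {1..K} then \<pi> x else 0) \<partial>count_space UNIV)
      = (\<Sum>x\<in>{1..K}. ennreal (if x \<in> {1..K} then \<pi> x else 0))"
    by (rule nn_integral_count_space') auto
  also have "\<dots> = ennreal (\<Sum>x\<in>{1..K}. \<pi> x)"
    using assms by (subst sum_ennreal [symmetric]) (auto simp: params_def intro: less_imp_le)
  also have "\<dots> = 1"
    using assms by (simp add: params_def)
  finally show "(\<integral>\<^sup>+ x. ennreal (if x \<in> {1..K} then \<pi> x else 0) \<partial>count_space UNIV) = 1" .
qed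

lemma params_nonempty:
  assumes "K \<ge> 1"
  shows "params K \<noteq> {}"
proof -
  have "((\<lambda>_. 1 / real K), (\<lambda>_ _. 1 / 2)) \<in> params K"
    using assms by (auto simp: params_def divide_simps)
  then show ?thesis by blast
qed

lemma complete_lik_bounds:
  assumes "\<theta> \<in> params K"
  shows "0 < complete_lik n K z A \<theta>" "complete_lik n K z A \<theta> \<le> 1"
proof -
  obtain \<pi> H where \<theta>: "\<theta> = (\<pi>, H)" by force
  have pos: "0 < \<pi> a" if "a \<in> {1..K}" for a
    using assms that by (auto simp: \<theta> params_def)
  have sum: "(\<Sum>a=1..K. \<pi> a) = 1"
    using assms by (auto simp: \<theta> params_def)
  have le1: "\<pi> a \<le> 1" if "a \<in> {1..K}" for a
    using member_le_sum[OF that, of \<pi>] pos sum by (auto intro: less_imp_le)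
  have H: "0 < H a b" "H a b < 1" if "a \<in> {1..K}" "b \<in> {1..K}" for a b
    using assms that by (auto simp: \<theta> params_def)
  let ?P = "\<Prod>a=1..K. \<pi> a ^ block_size n z a"
  let ?Q = "\<Prod>a=1..K. \<Prod>b=1..K.
       H a b ^ edge_count n z A a b * (1 - H a b) ^ (pair_count n z a b - edge_count n z A a b)"
  have P: "0 < ?P" "?P \<le> 1"
    using pos le1 by (auto intro!: prod_pos prod_le_1 power_le_one intro: less_imp_le)
  have Q0: "0 < ?Q"
    using H by (intro prod_pos ballI mult_pos_pos zero_less_power) auto
  have Q1: "?Q \<le> 1"
    using H by (intro prod_le_1 conjI prod_nonneg ballI mult_le_one mult_nonneg_nonneg
        power_le_one zero_le_power) (auto intro: less_imp_le)
  show "0 < complete_lik n K z A \<theta>"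
    using P Q0 by (simp add: \<theta> complete_lik_def)
  show "complete_lik n K z A \<theta> \<le> 1"
    using P Q0 Q1 by (auto simp: \<theta> complete_lik_def intro!: mult_le_one)
qed

lemma bdd_above_ln_complete_lik:
  "bdd_above ((\<lambda>\<theta>. ln (complete_lik n K z A \<theta>)) ` params K)"
  using complete_lik_bounds by (intro bdd_aboveI2[of _ _ 0]) (simp add: ln_le_zero_iff)

lemma bdd_above_marginal_lik:
  "bdd_above ((\<lambda>\<theta>. marginal_lik n K A \<theta>) ` params K)"
  unfolding marginal_lik_def
  by (intro bdd_aboveI2[of _ _ "\<Sum>z\<in>labelings n K. 1"] sum_mono complete_lik_bounds(2))

lemma marginal_lik_pos:
  assumes "\<theta> \<in> params K" "K \<ge> 1"
  shows "0 < marginal_lik n K A \<theta>"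
proof -
  have "finite (labelings n K)"
    unfolding labelings_def by (intro finite_PiE) auto
  moreover have "labelings n K \<noteq> {}"
    using assms(2) by (auto simp: labelings_def PiE_eq_empty_iff)
  ultimately show ?thesis
    unfolding marginal_lik_def using assms(1) by (intro sum_pos complete_lik_bounds(1)) auto
qed

end

theory Submission
  imports Defs
begin

text \<open>
  The idea is that of Shtarkov's bound from universal coding: the maximised likelihood of a model,
  summed over all possible data sets, measures the richness of the model, and it bounds the mean of
  the maximised likelihood relative to any fixed law on the data.

  Let \<open>m(A)\<close> be the supremum of the likelihood \<open>g(A; \<theta>)\<close> over the parameters of the model with
  \<open>K'\<close> blocks. It is at most the sum over the \<open>K'^n\<close> labelings \<open>z\<close> of the supremum of the likelihood
  of the edges given \<open>z\<close>. Given \<open>z\<close>, the edges are Bernoulli trials whose success probabilities are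
  constant on the at most \<open>K'\<^sup>2\<close> classes of pairs, so the supremum is the likelihood at the
  empirical frequencies. These take at most \<open>(n\<^sup>2 + 1)^(K'\<^sup>2)\<close> values, a number that is
  subexponential in \<open>n\<close>, and for each fixed value the likelihood sums to 1 over all graphs
  (\<open>sum_max_bernoulli_lik_le\<close>). Hence the sum of \<open>m(A)\<close> over all graphs is at most exponential in
  \<open>n\<close> (\<open>sum_sup_lik_le\<close>).

  The denominator of the likelihood ratio is at least the true likelihood, which is the probability
  of the observed graph (\<open>pmf_edge_law\<close>). The mean of the likelihood ratio under the true law is
  therefore at most the sum of \<open>m(A)\<close>, and by Markov's inequality the log likelihood ratio exceeds
  a large multiple of \<open>n\<close> only with exponentially small probability.

  In the other direction the log likelihood ratio is never below \<open>- n ln 2\<close>: the larger model may put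
  half of its label mass on the blocks of the smaller one, which costs a factor 2 per node
  (\<open>sup_lik_le_more_blocks\<close>). Together this gives a tail bound for each \<open>n\<close>
  (\<open>log_lik_ratio_tail\<close>), uniform over all true parameters.
\<close>

section \<open>Maximum likelihood for grouped Bernoulli trials\<close>

definition bernoulli_lik :: "'p set \<Rightarrow> ('p \<Rightarrow> real) \<Rightarrow> ('p \<Rightarrow> bool) \<Rightarrow> real" where
  "bernoulli_lik P q e = (\<Prod>p\<in>P. if e p then q p else 1 - q p)"

lemma bernoulli_lik_nonneg:
  assumes "\<And>p. p \<in> P \<Longrightarrow> 0 \<le> q p \<and> q p \<le> 1"
  shows "0 \<le> bernoulli_lik P q e"
  using assms by (auto simp: bernoulli_lik_def intro!: prod_nonneg)

lemma pmf_Pi_bernoulli: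
  assumes "finite P" "\<And>p. p \<in> P \<Longrightarrow> 0 \<le> q p \<and> q p \<le> 1" "e \<in> PiE_dflt P False (\<lambda>_. UNIV)"
  shows "pmf (Pi_pmf P False (\<lambda>p. bernoulli_pmf (q p))) e = bernoulli_lik P q e"
proof -
  have "pmf (Pi_pmf P False (\<lambda>p. bernoulli_pmf (q p))) e
      = (\<Prod>p\<in>P. pmf (bernoulli_pmf (q p)) (e p))"
    using assms(1,3) by (intro pmf_Pi') (auto simp: PiE_dflt_def)
  also have "\<dots> = bernoulli_lik P q e"
    unfolding bernoulli_lik_def using assms(2) by (intro prod.cong) auto
  finally show ?thesis .
qed

lemma finite_indicators: "finite P \<Longrightarrow> finite (PiE_dflt P False (\<lambda>_. UNIV))"
  by (rule finite_PiE_dflt) auto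

lemma sum_bernoulli_lik:
  assumes "finite P" "\<And>p. p \<in> P \<Longrightarrow> 0 \<le> q p \<and> q p \<le> 1"
  shows "(\<Sum>e\<in>PiE_dflt P False (\<lambda>_. UNIV). bernoulli_lik P q e) = 1"
proof -
  have "(\<Sum>e\<in>PiE_dflt P False (\<lambda>_. UNIV). bernoulli_lik P q e)
      = (\<Sum>e\<in>PiE_dflt P False (\<lambda>_. UNIV). pmf (Pi_pmf P False (\<lambda>p. bernoulli_pmf (q p))) e)"
    using assms by (intro sum.cong) (auto simp: pmf_Pi_bernoulli)
  also have "\<dots> = 1"
    using set_Pi_pmf_subset[OF assms(1), of False "\<lambda>p. bernoulli_pmf (q p)"] assms(1)
    by (intro sum_pmf_eq_1 finite_indicators) (auto simp: PiE_dflt_def)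
  finally show ?thesis .
qed

text \<open>
  This is the nonnegativity of the Kullback-Leibler divergence of the Bernoulli law with parameter
  \<open>k / m\<close> relative to the one with parameter \<open>x\<close>, which follows from \<open>ln t \<le> t - 1\<close>. The logarithms exist
  only away from the endpoints, so the degenerate values of \<open>k\<close> and \<open>x\<close> are treated apart.
\<close>

lemma bernoulli_power_le_frequency:
  fixes x :: real
  assumes "k \<le> m" "0 \<le> x" "x \<le> 1"
  shows "x ^ k * (1 - x) ^ (m - k) \<le> (real k / real m) ^ k * (1 - real k / real m) ^ (m - k)"
proof -
  consider "k = 0" | "k = m" | "x = 0 \<or> x = 1" "0 < k" "k < m" | "0 < k" "k < m" "0 < x" "x < 1"
    using assms by linarith
  then show ?thesis
  proof cases
    case 1
    then show ?thesis using assms by (simp add: power_le_one)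
  next
    case 2
    then show ?thesis using assms by (cases "m = 0") (auto simp: power_le_one)
  next
    case 3
    then show ?thesis by (auto simp: zero_power)
  next
    case 4
    define y where "y = real k / real m"
    have y: "0 < y" "y < 1" using 4 by (auto simp: y_def)
    have ym: "y * real m = real k" using 4 by (simp add: y_def)
    have "real k * ln (x / y) + real (m - k) * ln ((1 - x) / (1 - y))
        \<le> real k * (x / y - 1) + real (m - k) * ((1 - x) / (1 - y) - 1)"
      using 4 y by (intro add_mono mult_left_mono ln_le_minus_one) auto
    also have "\<dots> = real m * (x - y) + real m * ((1 - x) - (1 - y))"
    proof -
      have "real k * (x / y - 1) = real m * (x - y)"
        using y by (simp add: ym[symmetric] field_simps)
      moreover have "real (m - k) * ((1 - x) / (1 - y) - 1) = real m * ((1 - x) - (1 - y))"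
      proof -
        have "real (m - k) = real m * (1 - y)" using 4 ym by (simp add: of_nat_diff algebra_simps)
        then show ?thesis using y by (simp only:) (simp add: field_simps)
      qed
      ultimately show ?thesis by simp
    qed
    also have "\<dots> = 0" by (simp add: algebra_simps)
    finally have "real k * ln x + real (m - k) * ln (1 - x)
        \<le> real k * ln y + real (m - k) * ln (1 - y)"
      using 4 y by (simp add: ln_div algebra_simps)
    then have "ln (x ^ k * (1 - x) ^ (m - k)) \<le> ln (y ^ k * (1 - y) ^ (m - k))"
      using 4 y by (simp add: ln_mult ln_realpow)
    then show ?thesis using 4 y by (simp flip: y_def)
  qed
qed

text \<open>
  On a class \<open>c\<close> that contains no point of \<open>P\<close> this is \<open>0 / 0 = 0\<close>, which is still a probability.
\<close>

definition empirical_freq :: "'p set \<Rightarrow> ('p \<Rightarrow> 'c) \<Rightarrow> ('p \<Rightarrow> bool) \<Rightarrow> 'c \<Rightarrow> real" where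
  "empirical_freq P cl e c = real (card {p\<in>P. cl p = c \<and> e p}) / real (card {p\<in>P. cl p = c})"

lemma empirical_freq_bounds:
  assumes "finite P"
  shows "0 \<le> empirical_freq P cl e c" "empirical_freq P cl e c \<le> 1"
proof -
  have "card {p\<in>P. cl p = c \<and> e p} \<le> card {p\<in>P. cl p = c}"
    using assms by (intro card_mono) auto
  then show "0 \<le> empirical_freq P cl e c" "empirical_freq P cl e c \<le> 1"
    by (auto simp: empirical_freq_def divide_le_eq_1)
qed

lemma bernoulli_lik_grouped:
  assumes "finite P"
  shows "bernoulli_lik P (\<lambda>p. q (cl p)) e = (\<Prod>c\<in>cl ` P.
     q c ^ card {p\<in>P. cl p = c \<and> e p}
     * (1 - q c) ^ (card {p\<in>P. cl p = c} - card {p\<in>P. cl p = c \<and> e p}))"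
proof -
  have "(\<Prod>p\<in>{p\<in>P. cl p = c}. if e p then q (cl p) else 1 - q (cl p))
      = q c ^ card {p\<in>P. cl p = c \<and> e p}
        * (1 - q c) ^ (card {p\<in>P. cl p = c} - card {p\<in>P. cl p = c \<and> e p})" for c
  proof -
    let ?B = "{p\<in>P. cl p = c}" and ?E = "{p\<in>P. cl p = c \<and> e p}"
    have "(\<Prod>p\<in>?B. if e p then q (cl p) else 1 - q (cl p)) = (\<Prod>p\<in>?B. if e p then q c else 1 - q c)"
      by (intro prod.cong) auto
    also have "\<dots> = q c ^ card {p\<in>?B. e p} * (1 - q c) ^ card {p\<in>?B. \<not> e p}"
      using assms by (subst prod.If_cases) (auto simp: Int_def)
    also have "{p\<in>?B. e p} = ?E" by auto
    also have "{p\<in>?B. \<not> e p} = ?B - ?E" by auto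
    also have "card (?B - ?E) = card ?B - card ?E"
      using assms by (intro card_Diff_subset) auto
    finally show ?thesis .
  qed
  then show ?thesis
    unfolding bernoulli_lik_def by (subst prod.image_gen[OF assms, of _ cl]) simp
qed

lemma bernoulli_lik_le_empirical:
  assumes "finite P" "\<And>c. c \<in> cl ` P \<Longrightarrow> 0 \<le> q c \<and> q c \<le> 1"
  shows "bernoulli_lik P (\<lambda>p. q (cl p)) e \<le> bernoulli_lik P (\<lambda>p. empirical_freq P cl e (cl p)) e"
  unfolding bernoulli_lik_grouped[OF assms(1)]
proof (rule prod_mono, intro conjI)
  fix c assume c: "c \<in> cl ` P"
  then show "0 \<le> q c ^ card {p\<in>P. cl p = c \<and> e p}
      * (1 - q c) ^ (card {p\<in>P. cl p = c} - card {p\<in>P. cl p = c \<and> e p})"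
    using assms(2)[of c] by simp
  have "card {p\<in>P. cl p = c \<and> e p} \<le> card {p\<in>P. cl p = c}"
    using assms by (intro card_mono) auto
  then show "q c ^ card {p\<in>P. cl p = c \<and> e p}
      * (1 - q c) ^ (card {p\<in>P. cl p = c} - card {p\<in>P. cl p = c \<and> e p})
    \<le> empirical_freq P cl e c ^ card {p\<in>P. cl p = c \<and> e p}
      * (1 - empirical_freq P cl e c) ^ (card {p\<in>P. cl p = c} - card {p\<in>P. cl p = c \<and> e p})"
    unfolding empirical_freq_def using assms(2)[OF c] by (intro bernoulli_power_le_frequency) auto
qed

text \<open>
  The likelihood at the frequencies of \<open>e\<close> itself is one of the terms of the sum of the likelihoods
  of \<open>e\<close> over all frequency vectors \<open>q\<close> that can occur. After the two sums are exchanged, each \<open>q\<close>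
  contributes a total probability of 1, so it remains to count the frequency vectors. They
  are determined by the number of successes in each class.
\<close>

lemma sum_max_bernoulli_lik_le:
  assumes "finite P" "finite C" "cl ` P \<subseteq> C"
  shows "(\<Sum>e\<in>PiE_dflt P False (\<lambda>_. UNIV). bernoulli_lik P (\<lambda>p. empirical_freq P cl e (cl p)) e)
    \<le> (real (card P) + 1) ^ card C"
proof -
  let ?\<Omega> = "PiE_dflt P False (\<lambda>_. UNIV)"
  (* As a function on the whole class type a frequency vector also has values off C; restriction makes it a
     function of the counts on C alone. *)
  define freq where "freq e = restrict (empirical_freq P cl e) C" for e
  define of_counts where
    "of_counts k = restrict (\<lambda>c. real (k c) / real (card {p\<in>P. cl p = c})) C" for k :: "'b \<Rightarrow> nat"
  have fin: "finite ?\<Omega>" using assms(1) by (rule finite_indicators)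
  have lik: "bernoulli_lik P (\<lambda>p. freq e' (cl p)) e = bernoulli_lik P (\<lambda>p. empirical_freq P cl e' (cl p)) e"
    for e e' using assms(3) unfolding bernoulli_lik_def freq_def by (intro prod.cong) auto
  have freq01: "0 \<le> freq e (cl p) \<and> freq e (cl p) \<le> 1" if "p \<in> P" for e p
    using that assms(3) empirical_freq_bounds[OF assms(1)] by (auto simp: freq_def)
  have "(\<Sum>e\<in>?\<Omega>. bernoulli_lik P (\<lambda>p. empirical_freq P cl e (cl p)) e)
      = (\<Sum>e\<in>?\<Omega>. bernoulli_lik P (\<lambda>p. freq e (cl p)) e)"
    by (simp add: lik)
  also have "\<dots> \<le> (\<Sum>e\<in>?\<Omega>. \<Sum>q\<in>freq ` ?\<Omega>. bernoulli_lik P (\<lambda>p. q (cl p)) e)"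
    using fin freq01
    by (intro sum_mono member_le_sum[where f="\<lambda>q. bernoulli_lik P (\<lambda>p. q (cl p)) _"])
      (auto intro!: bernoulli_lik_nonneg)
  also have "\<dots> = (\<Sum>q\<in>freq ` ?\<Omega>. \<Sum>e\<in>?\<Omega>. bernoulli_lik P (\<lambda>p. q (cl p)) e)"
    by (rule sum.swap)
  also have "\<dots> = (\<Sum>q\<in>freq ` ?\<Omega>. 1)"
    using freq01 assms(1) by (intro sum.cong refl sum_bernoulli_lik) auto
  also have "\<dots> = real (card (freq ` ?\<Omega>))" by simp
  also have "\<dots> \<le> real (card (C \<rightarrow>\<^sub>E {..card P}))"
  proof -
    have "freq ` ?\<Omega> \<subseteq> of_counts ` (C \<rightarrow>\<^sub>E {..card P})"
    proof (rule image_subsetI)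
      fix e assume "e \<in> ?\<Omega>"
      let ?k = "restrict (\<lambda>c. card {p\<in>P. cl p = c \<and> e p}) C"
      have "?k \<in> C \<rightarrow>\<^sub>E {..card P}"
        using assms(1) by (auto intro!: card_mono)
      moreover have "freq e = of_counts ?k"
        by (auto simp: freq_def of_counts_def empirical_freq_def restrict_def)
      ultimately show "freq e \<in> of_counts ` (C \<rightarrow>\<^sub>E {..card P})" by blast
    qed
    then show ?thesis
      using assms(2) by (intro of_nat_mono surj_card_le finite_PiE) auto
  qed
  also have "\<dots> = (real (card P) + 1) ^ card C"
    using assms(2) by (simp add: card_PiE add.commute)
  finally show ?thesis .
qed

section \<open>The block model likelihood as a probability mass function\<close>

definition node_pairs :: "nat \<Rightarrow> (nat \<times> nat) set" where
  "node_pairs n = {(i, j). 1 \<le> i \<and> i < j \<and> j \<le> n}"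

definition adjacency_of :: "(nat \<times> nat \<Rightarrow> bool) \<Rightarrow> adjacency" where
  "adjacency_of e = (\<lambda>i j. of_bool (e (min i j, max i j)))"

definition pair_class :: "labeling \<Rightarrow> nat \<times> nat \<Rightarrow> nat \<times> nat" where
  "pair_class z = (\<lambda>(i, j). (z i, z j))"

abbreviation edge_sets :: "nat \<Rightarrow> (nat \<times> nat \<Rightarrow> bool) set" where
  "edge_sets n \<equiv> PiE_dflt (node_pairs n) False (\<lambda>_. UNIV)"

text \<open>
  The law of the graph, with the latent labels integrated out, on the edge indicators of the pairs
  \<open>i < j\<close>. Indexing by these pairs rather than by the symmetric matrix makes the conditional law
  given the labels a plain product.
\<close>

definition edge_law :: "nat \<Rightarrow> nat \<Rightarrow> param \<Rightarrow> (nat \<times> nat \<Rightarrow> bool) pmf" where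
  "edge_law n K = (\<lambda>(\<pi>, H).
     Pi_pmf {1..n} undefined (\<lambda>_. label_pmf K \<pi>) \<bind> (\<lambda>Z.
       Pi_pmf (node_pairs n) False (\<lambda>p. bernoulli_pmf (case_prod H (pair_class Z p)))))"

lemma node_pairs_subset: "node_pairs n \<subseteq> {1..n} \<times> {1..n}"
  by (auto simp: node_pairs_def)

lemma finite_node_pairs: "finite (node_pairs n)"
  using node_pairs_subset by (rule finite_subset) simp

lemma card_node_pairs_le: "card (node_pairs n) \<le> n * n"
  using card_mono[OF _ node_pairs_subset, of n] by simp

lemma finite_labelings: "finite (labelings n K)"
  unfolding labelings_def by (intro finite_PiE) auto

lemma labelings_mem: "z \<in> labelings n K \<Longrightarrow> i \<in> {1..n} \<Longrightarrow> z i \<in> {1..K}"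
  by (auto simp: labelings_def)

lemma pair_class_mem:
  "z \<in> labelings n K \<Longrightarrow> p \<in> node_pairs n \<Longrightarrow> pair_class z p \<in> {1..K} \<times> {1..K}"
  using node_pairs_subset by (fastforce simp: labelings_def pair_class_def)

lemma map_snd_sbm: "map_pmf snd (sbm n K \<theta>) = map_pmf adjacency_of (edge_law n K \<theta>)"
  by (cases \<theta>) (simp add: sbm_def edge_law_def map_bind_pmf pair_class_def node_pairs_def
      adjacency_of_def case_prod_unfold map_pmf_def bind_assoc_pmf bind_return_pmf)

text \<open>
  The likelihood in terms of block counts runs over ordered pairs of nodes, hence over every edge
  indicator twice; this is the square that its square root removes.
\<close>

lemma prod_off_diagonal:
  fixes h :: "nat \<Rightarrow> nat \<Rightarrow> real"
  assumes "\<And>i j. i \<in> {1..n} \<Longrightarrow> j \<in> {1..n} \<Longrightarrow> h i j = h j i"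
  shows "(\<Prod>i=1..n. \<Prod>j\<in>{1..n} - {i}. h i j) = (\<Prod>(i, j)\<in>node_pairs n. h i j)\<^sup>2"
proof -
  let ?D = "SIGMA i:{1..n}. {1..n} - {i}"
  have D: "?D = node_pairs n \<union> prod.swap ` node_pairs n"
    by (auto simp: node_pairs_def image_iff)
  have "(\<Prod>i=1..n. \<Prod>j\<in>{1..n} - {i}. h i j) = (\<Prod>(i, j)\<in>?D. h i j)"
    by (rule prod.Sigma) auto
  also have "\<dots> = (\<Prod>(i, j)\<in>node_pairs n. h i j) * (\<Prod>(i, j)\<in>prod.swap ` node_pairs n. h i j)"
    unfolding D using finite_node_pairs by (intro prod.union_disjoint) (auto simp: node_pairs_def)
  also have "(\<Prod>(i, j)\<in>prod.swap ` node_pairs n. h i j) = (\<Prod>(i, j)\<in>node_pairs n. h j i)"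
    by (subst prod.reindex) (auto simp: case_prod_unfold)
  also have "\<dots> = (\<Prod>(i, j)\<in>node_pairs n. h i j)"
    using assms by (intro prod.cong) (auto simp: node_pairs_def)
  finally show ?thesis by (simp add: power2_eq_square)
qed

lemma prod_over_classes:
  fixes g :: "nat \<Rightarrow> nat \<Rightarrow> real"
  assumes "i \<in> {1..n}" "j \<in> {1..n}" "z \<in> labelings n K"
  shows "(\<Prod>a=1..K. \<Prod>b=1..K. g a b ^ (of_bool (z i = a \<and> z j = b) * c)) = g (z i) (z j) ^ c"
proof -
  have z: "z i \<in> {1..K}" "z j \<in> {1..K}" using assms by (auto simp: labelings_def)
  have "(\<Prod>a=1..K. \<Prod>b=1..K. g a b ^ (of_bool (z i = a \<and> z j = b) * c))
      = (\<Prod>a=1..K. \<Prod>b=1..K. if b = z j then (if a = z i then g a b ^ c else 1) else 1)"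
    by (intro prod.cong) auto
  also have "\<dots> = g (z i) (z j) ^ c" using z by (simp add: prod.delta)
  finally show ?thesis .
qed

text \<open>
  Regrouping from pairs of blocks to pairs of nodes: every pair of nodes is counted for exactly one
  pair of blocks, namely that of its labels. The weight \<open>c\<close> is \<open>A i j\<close> for the edges and
  \<open>1 - A i j\<close> for the non-edges.
\<close>

lemma prod_pow_count:
  fixes g :: "nat \<Rightarrow> nat \<Rightarrow> real"
  assumes "z \<in> labelings n K"
  shows "(\<Prod>a=1..K. \<Prod>b=1..K.
      g a b ^ (\<Sum>i=1..n. \<Sum>j\<in>{1..n} - {i}. of_bool (z i = a \<and> z j = b) * c i j))
    = (\<Prod>i=1..n. \<Prod>j\<in>{1..n} - {i}. g (z i) (z j) ^ c i j)"
proof -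
  let ?f = "\<lambda>a b i j. g a b ^ (of_bool (z i = a \<and> z j = b) * c i j)"
  have "(\<Prod>a=1..K. \<Prod>b=1..K.
      g a b ^ (\<Sum>i=1..n. \<Sum>j\<in>{1..n} - {i}. of_bool (z i = a \<and> z j = b) * c i j))
    = (\<Prod>a=1..K. \<Prod>b=1..K. \<Prod>i=1..n. \<Prod>j\<in>{1..n} - {i}. ?f a b i j)"
    by (simp only: power_sum)
  also have "\<dots> = (\<Prod>a=1..K. \<Prod>i=1..n. \<Prod>b=1..K. \<Prod>j\<in>{1..n} - {i}. ?f a b i j)"
    by (intro prod.cong refl prod.swap)
  also have "\<dots> = (\<Prod>i=1..n. \<Prod>a=1..K. \<Prod>b=1..K. \<Prod>j\<in>{1..n} - {i}. ?f a b i j)"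
    by (rule prod.swap)
  also have "\<dots> = (\<Prod>i=1..n. \<Prod>a=1..K. \<Prod>j\<in>{1..n} - {i}. \<Prod>b=1..K. ?f a b i j)"
    by (intro prod.cong refl prod.swap)
  also have "\<dots> = (\<Prod>i=1..n. \<Prod>j\<in>{1..n} - {i}. \<Prod>a=1..K. \<Prod>b=1..K. ?f a b i j)"
    by (intro prod.cong refl prod.swap)
  also have "\<dots> = (\<Prod>i=1..n. \<Prod>j\<in>{1..n} - {i}. g (z i) (z j) ^ c i j)"
    using assms by (intro prod.cong refl prod_over_classes) auto
  finally show ?thesis .
qed

text \<open>
  In this form the complete-data likelihood is visibly a probability of labels times a conditional
  probability of edges, and given the labels it is a product of Bernoulli trials grouped by the
  label pairs of their nodes.
\<close>

lemma complete_lik_adjacency_of: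
  assumes \<theta>: "(\<pi>, H) \<in> params K" and z: "z \<in> labelings n K"
  shows "complete_lik n K z (adjacency_of e) (\<pi>, H)
    = (\<Prod>i=1..n. \<pi> (z i)) * bernoulli_lik (node_pairs n) (\<lambda>p. case_prod H (pair_class z p)) e"
proof -
  let ?A = "adjacency_of e"
  let ?h = "\<lambda>i j. H (z i) (z j) ^ ?A i j * (1 - H (z i) (z j)) ^ (1 - ?A i j)"
  have zK: "z i \<in> {1..K}" if "i \<in> {1..n}" for i
    using z that by (auto simp: labelings_def)
  have H: "0 < H (z i) (z j)" "H (z i) (z j) < 1" "H (z i) (z j) = H (z j) (z i)"
    if "i \<in> {1..n}" "j \<in> {1..n}" for i j
    using \<theta> zK that unfolding params_def by blast+
  have A: "?A i j = ?A j i" "?A i j \<le> 1" for i j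
    by (auto simp: adjacency_of_def min.commute max.commute)
  have labels: "(\<Prod>a=1..K. \<pi> a ^ block_size n z a) = (\<Prod>i=1..n. \<pi> (z i))"
  proof -
    have "(\<Prod>a=1..K. \<pi> a ^ block_size n z a) = (\<Prod>a=1..K. \<Prod>i=1..n. \<pi> a ^ of_bool (z i = a))"
      by (simp only: block_size_def power_sum)
    also have "\<dots> = (\<Prod>i=1..n. \<Prod>a=1..K. \<pi> a ^ of_bool (z i = a))"
      by (rule prod.swap)
    also have "\<dots> = (\<Prod>i=1..n. \<Prod>a=1..K. if a = z i then \<pi> a else 1)"
      by (intro prod.cong) auto
    also have "\<dots> = (\<Prod>i=1..n. \<pi> (z i))"
      using zK by (intro prod.cong refl) (simp add: prod.delta)
    finally show ?thesis .
  qed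
  have non_edges: "pair_count n z a b - edge_count n z ?A a b
      = (\<Sum>i=1..n. \<Sum>j\<in>{1..n} - {i}. of_bool (z i = a \<and> z j = b) * (1 - ?A i j))" for a b
  proof -
    have split: "of_bool (z i = a \<and> z j = b)
        = of_bool (z i = a \<and> z j = b) * ?A i j + of_bool (z i = a \<and> z j = b) * (1 - ?A i j)" for i j
      using A(2)[of i j] by auto
    have "pair_count n z a b = edge_count n z ?A a b
      + (\<Sum>i=1..n. \<Sum>j\<in>{1..n} - {i}. of_bool (z i = a \<and> z j = b) * (1 - ?A i j))"
      unfolding pair_count_def edge_count_def sum.distrib[symmetric] by (intro sum.cong refl split)
    then show ?thesis by simp
  qed
  have "(\<Prod>a=1..K. \<Prod>b=1..K.
       H a b ^ edge_count n z ?A a b * (1 - H a b) ^ (pair_count n z a b - edge_count n z ?A a b))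
     = (\<Prod>i=1..n. \<Prod>j\<in>{1..n} - {i}. ?h i j)"
    unfolding non_edges unfolding edge_count_def prod.distrib prod_pow_count[OF z] ..
  also have "\<dots> = (\<Prod>(i, j)\<in>node_pairs n. ?h i j)\<^sup>2"
    using H A(1) by (intro prod_off_diagonal) metis
  also have "(\<Prod>(i, j)\<in>node_pairs n. ?h i j)
      = bernoulli_lik (node_pairs n) (\<lambda>p. case_prod H (pair_class z p)) e"
    unfolding bernoulli_lik_def
    by (intro prod.cong) (auto simp: node_pairs_def pair_class_def adjacency_of_def)
  finally have prod_eq: "(\<Prod>a=1..K. \<Prod>b=1..K.
       H a b ^ edge_count n z ?A a b * (1 - H a b) ^ (pair_count n z a b - edge_count n z ?A a b))
     = (bernoulli_lik (node_pairs n) (\<lambda>p. case_prod H (pair_class z p)) e)\<^sup>2" .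
  have "0 \<le> bernoulli_lik (node_pairs n) (\<lambda>p. case_prod H (pair_class z p)) e"
    using H by (intro bernoulli_lik_nonneg) (auto simp: node_pairs_def pair_class_def less_imp_le)
  then show ?thesis
    by (simp only: complete_lik_def prod.case labels prod_eq real_sqrt_abs abs_of_nonneg)
qed

lemma pmf_edge_law:
  assumes \<theta>: "\<theta> \<in> params K" and e: "e \<in> edge_sets n"
  shows "pmf (edge_law n K \<theta>) e = marginal_lik n K (adjacency_of e) \<theta>"
proof -
  obtain \<pi> H where \<theta>_eq: "\<theta> = (\<pi>, H)" by force
  let ?Z = "Pi_pmf {1..n} undefined (\<lambda>_. label_pmf K \<pi>)"
  have supp: "set_pmf ?Z \<subseteq> labelings n K"
  proof -
    have "set_pmf (label_pmf K \<pi>) \<subseteq> {1..K}"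
      using pmf_label_pmf[of \<pi> H K] \<theta> by (auto simp: \<theta>_eq set_pmf_iff split: if_splits)
    then show ?thesis
      using set_Pi_pmf_subset'[of "{1..n}" undefined "\<lambda>_. label_pmf K \<pi>"]
      by (fastforce simp: labelings_def PiE_dflt_def PiE_def Pi_def extensional_def)
  qed
  have pZ: "pmf ?Z z = (\<Prod>i=1..n. \<pi> (z i))" if "z \<in> labelings n K" for z
  proof -
    have "pmf ?Z z = (\<Prod>i=1..n. pmf (label_pmf K \<pi>) (z i))"
      using that by (intro pmf_Pi') (auto simp: labelings_def PiE_def extensional_def)
    also have "\<dots> = (\<Prod>i=1..n. \<pi> (z i))"
      using that \<theta> pmf_label_pmf[of \<pi> H K]
      by (intro prod.cong refl) (auto simp: \<theta>_eq labelings_def)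
    finally show ?thesis .
  qed
  have pe: "pmf (Pi_pmf (node_pairs n) False (\<lambda>p. bernoulli_pmf (case_prod H (pair_class z p)))) e
      = bernoulli_lik (node_pairs n) (\<lambda>p. case_prod H (pair_class z p)) e"
    if "z \<in> labelings n K" for z
    using e pair_class_mem[OF that] \<theta>
    by (intro pmf_Pi_bernoulli finite_node_pairs)
      (fastforce simp: \<theta>_eq params_def intro: less_imp_le)+
  have "pmf (edge_law n K \<theta>) e = (\<Sum>z\<in>labelings n K.
      pmf (Pi_pmf (node_pairs n) False (\<lambda>p. bernoulli_pmf (case_prod H (pair_class z p)))) e * pmf ?Z z)"
    unfolding edge_law_def \<theta>_eq prod.case pmf_bind
    using supp by (intro integral_measure_pmf_real finite_labelings) auto
  also have "\<dots> = marginal_lik n K (adjacency_of e) \<theta>"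
    unfolding marginal_lik_def \<theta>_eq
    by (intro sum.cong refl)
      (simp only: pZ pe complete_lik_adjacency_of[OF \<theta>[unfolded \<theta>_eq]] mult.commute)
  finally show ?thesis .
qed

lemma set_edge_law: "set_pmf (edge_law n K \<theta>) \<subseteq> edge_sets n"
  using set_Pi_pmf_subset[OF finite_node_pairs, of n False]
  by (cases \<theta>) (fastforce simp: edge_law_def PiE_dflt_def)

section \<open>Bounds for the likelihood ratio\<close>

definition sup_lik :: "nat \<Rightarrow> nat \<Rightarrow> adjacency \<Rightarrow> real" where
  "sup_lik n K A = (SUP \<theta>\<in>params K. marginal_lik n K A \<theta>)"

lemma marginal_lik_le_sup: "\<theta> \<in> params K \<Longrightarrow> marginal_lik n K A \<theta> \<le> sup_lik n K A"
  unfolding sup_lik_def by (intro cSUP_upper bdd_above_marginal_lik)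

lemma sup_lik_pos: "K \<ge> 1 \<Longrightarrow> 0 < sup_lik n K A"
  using params_nonempty[of K] marginal_lik_pos marginal_lik_le_sup
  by (meson all_not_in_conv less_le_trans)

text \<open>
  Bounding the label probabilities by 1 costs only the number \<open>K^n\<close> of labelings, and bounding the
  supremum of a sum by the sum of the suprema reduces the claim to fixed \<open>z\<close>, where
  \<open>sum_max_bernoulli_lik_le\<close> applies. The crude estimate \<open>n\<^sup>2 + 1 \<le> 4^n\<close> is enough for an
  exponential bound.
\<close>

lemma sum_sup_lik_le:
  assumes "K \<ge> 1"
  shows "(\<Sum>e\<in>edge_sets n. sup_lik n K (adjacency_of e)) \<le> (real K * 4 ^ (K * K)) ^ n"
proof -
  define M where "M z e = bernoulli_lik (node_pairs n)
     (\<lambda>p. empirical_freq (node_pairs n) (pair_class z) e (pair_class z p)) e" for z e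
  have sup_le: "sup_lik n K (adjacency_of e) \<le> (\<Sum>z\<in>labelings n K. M z e)" for e
    unfolding sup_lik_def
  proof (rule cSUP_least)
    show "params K \<noteq> {}" using assms by (rule params_nonempty)
    fix \<theta> assume \<theta>: "\<theta> \<in> params K"
    obtain \<pi> H where \<theta>_eq: "\<theta> = (\<pi>, H)" by force
    have "complete_lik n K z (adjacency_of e) \<theta> \<le> M z e" if z: "z \<in> labelings n K" for z
    proof -
      have \<pi>0: "0 \<le> \<pi> a" if "a \<in> {1..K}" for a
        using \<theta> that by (auto simp: \<theta>_eq params_def intro: less_imp_le)
      have \<pi>1: "\<pi> a \<le> 1" if "a \<in> {1..K}" for a
        using member_le_sum[OF that, of \<pi>] \<pi>0 \<theta> by (auto simp: \<theta>_eq params_def)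
      have H: "0 \<le> case_prod H c \<and> case_prod H c \<le> 1" if "c \<in> pair_class z ` node_pairs n" for c
        using that \<theta> pair_class_mem[OF z] by (fastforce simp: \<theta>_eq params_def intro: less_imp_le)
      have "(\<Prod>i=1..n. \<pi> (z i)) \<le> 1"
        using labelings_mem[OF z] \<pi>0 \<pi>1 by (intro prod_le_1) auto
      moreover have "bernoulli_lik (node_pairs n) (\<lambda>p. case_prod H (pair_class z p)) e \<le> M z e"
        unfolding M_def using H by (intro bernoulli_lik_le_empirical finite_node_pairs)
      moreover have "0 \<le> bernoulli_lik (node_pairs n) (\<lambda>p. case_prod H (pair_class z p)) e"
        using H by (intro bernoulli_lik_nonneg) auto
      ultimately have "(\<Prod>i=1..n. \<pi> (z i))
          * bernoulli_lik (node_pairs n) (\<lambda>p. case_prod H (pair_class z p)) e \<le> 1 * M z e"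
        by (intro mult_mono) auto
      then show ?thesis
        using \<theta> z by (simp add: \<theta>_eq complete_lik_adjacency_of)
    qed
    then show "marginal_lik n K (adjacency_of e) \<theta> \<le> (\<Sum>z\<in>labelings n K. M z e)"
      unfolding marginal_lik_def by (rule sum_mono)
  qed
  have types: "real (card (node_pairs n)) + 1 \<le> 4 ^ n"
  proof -
    have "card (node_pairs n) + 1 \<le> (n + 1) * (n + 1)"
      using card_node_pairs_le[of n] by simp
    also have "\<dots> \<le> 2 ^ n * 2 ^ n"
      by (intro mult_mono) (auto simp: Suc_le_eq)
    also have "\<dots> = 4 ^ n" by (simp flip: power_mult_distrib)
    finally have "real (card (node_pairs n) + 1) \<le> real (4 ^ n)" by (rule of_nat_mono)
    then show ?thesis by simp
  qed
  have "(\<Sum>e\<in>edge_sets n. sup_lik n K (adjacency_of e))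
      \<le> (\<Sum>e\<in>edge_sets n. \<Sum>z\<in>labelings n K. M z e)"
    by (intro sum_mono sup_le)
  also have "\<dots> = (\<Sum>z\<in>labelings n K. \<Sum>e\<in>edge_sets n. M z e)"
    by (rule sum.swap)
  also have "\<dots> \<le> (\<Sum>z\<in>labelings n K. (real (card (node_pairs n)) + 1) ^ card ({1..K} \<times> {1..K}))"
    unfolding M_def using pair_class_mem
    by (intro sum_mono sum_max_bernoulli_lik_le finite_node_pairs) blast+
  also have "\<dots> = real K ^ n * (real (card (node_pairs n)) + 1) ^ (K * K)"
    by (simp add: labelings_def card_PiE)
  also have "\<dots> \<le> real K ^ n * (4 ^ n) ^ (K * K)"
    using types by (intro mult_left_mono power_mono) auto
  also have "\<dots> = (real K * 4 ^ (K * K)) ^ n"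
    by (simp add: power_mult_distrib mult.commute flip: power_mult)
  finally show ?thesis .
qed

text \<open>
  Given \<open>\<theta>\<close> for \<open>K\<close> blocks, halve its label probabilities and share the remaining mass \<open>1 / 2\<close>
  equally among the additional blocks, with arbitrary edge probabilities there. A labeling that uses
  only the old blocks then loses exactly the factor \<open>2^n\<close>, and the other labelings add nonnegative
  terms.
\<close>

lemma sup_lik_le_more_blocks:
  assumes "K \<ge> 1" "K < K'"
  shows "sup_lik n K (adjacency_of e) \<le> 2 ^ n * sup_lik n K' (adjacency_of e)"
  unfolding sup_lik_def[of n K]
proof (rule cSUP_least)
  show "params K \<noteq> {}" using assms(1) by (rule params_nonempty)
  fix \<theta> assume \<theta>: "\<theta> \<in> params K"
  obtain \<pi> H where \<theta>_eq: "\<theta> = (\<pi>, H)" by force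
  define \<pi>' where "\<pi>' a = (if a \<le> K then \<pi> a / 2 else 1 / (2 * real (K' - K)))" for a
  define H' where "H' a b = (if a \<le> K \<and> b \<le> K then H a b else 1 / 2)" for a b
  have \<pi>0: "0 < \<pi> a" if "a \<in> {1..K}" for a
    using \<theta> that by (auto simp: \<theta>_eq params_def)
  have \<pi>1: "\<pi> a \<le> 1" if "a \<in> {1..K}" for a
    using member_le_sum[OF that, of \<pi>] \<pi>0 \<theta> by (auto simp: \<theta>_eq params_def less_imp_le)
  have \<pi>'_bounds: "0 < \<pi>' a \<and> \<pi>' a < 1" if "a \<in> {1..K'}" for a
  proof (cases "a \<le> K")
    case True
    then show ?thesis using that \<pi>0[of a] \<pi>1[of a] by (simp add: \<pi>'_def)
  next
    case False
    then have "1 \<le> real (K' - K)" using assms(2) by auto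
    then show ?thesis using False assms(2) by (simp add: \<pi>'_def divide_simps)
  qed
  have "(\<Sum>a=1..K'. \<pi>' a) = (\<Sum>a=1..K. \<pi>' a) + (\<Sum>a=K+1..K'. \<pi>' a)"
    using assms sum.ub_add_nat[of 1 K \<pi>' "K' - K"] by simp
  also have "(\<Sum>a=1..K. \<pi>' a) = (\<Sum>a=1..K. \<pi> a) / 2"
    by (simp add: \<pi>'_def sum_divide_distrib)
  also have "(\<Sum>a=K+1..K'. \<pi>' a) = 1 / 2"
    using assms by (simp add: \<pi>'_def)
  finally have sum': "(\<Sum>a=1..K'. \<pi>' a) = 1"
    using \<theta> by (simp add: \<theta>_eq params_def)
  have H'_bounds: "0 < H' a b \<and> H' a b < 1 \<and> H' a b = H' b a"
    if "a \<in> {1..K'}" "b \<in> {1..K'}" for a b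
    using \<theta> that by (auto simp: H'_def \<theta>_eq params_def)
  have \<theta>': "(\<pi>', H') \<in> params K'"
    using \<pi>'_bounds sum' H'_bounds by (simp add: params_def)
  have sub: "labelings n K \<subseteq> labelings n K'"
    using assms unfolding labelings_def by (intro PiE_mono) auto
  have eq: "complete_lik n K z (adjacency_of e) \<theta> = 2 ^ n * complete_lik n K' z (adjacency_of e) (\<pi>', H')"
    if z: "z \<in> labelings n K" for z
  proof -
    have "(\<Prod>i=1..n. \<pi>' (z i)) = (\<Prod>i=1..n. \<pi> (z i) / 2)"
      using z by (intro prod.cong refl) (auto simp: \<pi>'_def labelings_def)
    also have "\<dots> = (\<Prod>i=1..n. \<pi> (z i)) / 2 ^ n"
      by (simp add: prod_dividef)
    finally have "(\<Prod>i=1..n. \<pi> (z i)) = 2 ^ n * (\<Prod>i=1..n. \<pi>' (z i))" by simp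
    moreover have "bernoulli_lik (node_pairs n) (\<lambda>p. case_prod H' (pair_class z p)) e
        = bernoulli_lik (node_pairs n) (\<lambda>p. case_prod H (pair_class z p)) e"
      unfolding bernoulli_lik_def using pair_class_mem[OF z]
      by (intro prod.cong refl) (fastforce simp: H'_def)
    ultimately show ?thesis
      using \<theta> \<theta>' z sub by (simp add: \<theta>_eq complete_lik_adjacency_of subset_iff)
  qed
  have "marginal_lik n K (adjacency_of e) \<theta>
      = 2 ^ n * (\<Sum>z\<in>labelings n K. complete_lik n K' z (adjacency_of e) (\<pi>', H'))"
    unfolding marginal_lik_def by (simp add: eq sum_distrib_left)
  also have "\<dots> \<le> 2 ^ n * marginal_lik n K' (adjacency_of e) (\<pi>', H')"
    unfolding marginal_lik_def
    using sub complete_lik_bounds(1)[OF \<theta>']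
    by (intro mult_left_mono sum_mono2 finite_labelings) (auto intro: less_imp_le)
  also have "\<dots> \<le> 2 ^ n * sup_lik n K' (adjacency_of e)"
    using \<theta>' by (intro mult_left_mono marginal_lik_le_sup) auto
  finally show "marginal_lik n K (adjacency_of e) \<theta> \<le> 2 ^ n * sup_lik n K' (adjacency_of e)" .
qed

text \<open>
  Markov's inequality for the ratio of the suprema: on the bad event a graph has probability at most
  \<open>exp (- C n)\<close> times its supremum over the larger model. Summing over all graphs gives
  \<open>exp (- C n)\<close> times the bound of \<open>sum_sup_lik_le\<close>, and the constant \<open>C\<close> exceeds the exponential
  rate of that bound by 1.
\<close>

lemma log_lik_ratio_tail:
  assumes K: "K \<ge> 1" "K < K'" and \<theta>: "\<theta> \<in> params K" and C: "C = 1 + ln (real K' * 4 ^ (K' * K'))"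
  shows "measure_pmf.prob (map_pmf snd (sbm n K \<theta>)) {A. \<bar>log_lik_ratio n K K' A\<bar> > C * real n}
    \<le> exp (- real n)"
proof -
  let ?A = adjacency_of
  let ?bad = "{e \<in> edge_sets n. exp (C * real n) * sup_lik n K (?A e) < sup_lik n K' (?A e)}"
  have fin: "finite (edge_sets n)" by (intro finite_indicators finite_node_pairs)
  have B: "1 \<le> (4 :: real) ^ (K' * K')" by simp
  have "2 * 1 \<le> real K' * 4 ^ (K' * K')"
    using K by (intro mult_mono B) auto
  (* Small values of the ratio are harmless, since its logarithm is at least - n ln 2. *)
  then have ln2: "ln 2 \<le> C" unfolding C
    by (smt (verit) ln_le_cancel_iff)
  have bad: "e \<in> ?bad"
    if e: "e \<in> edge_sets n" and large: "\<bar>log_lik_ratio n K K' (?A e)\<bar> > C * real n" for e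
  proof -
    have pos: "0 < sup_lik n K (?A e)" "0 < sup_lik n K' (?A e)"
      using K by (auto intro!: sup_lik_pos)
    have L: "log_lik_ratio n K K' (?A e) = ln (sup_lik n K' (?A e)) - ln (sup_lik n K (?A e))"
      using pos by (simp add: log_lik_ratio_def ln_div flip: sup_lik_def)
    have "ln (sup_lik n K (?A e)) \<le> ln (2 ^ n * sup_lik n K' (?A e))"
      using sup_lik_le_more_blocks[OF K, of n e] pos by (subst ln_le_cancel_iff) auto
    then have "- log_lik_ratio n K K' (?A e) \<le> ln 2 * real n"
      using pos by (simp add: L ln_mult ln_realpow mult.commute)
    also have "\<dots> \<le> C * real n" using ln2 by (intro mult_right_mono) auto
    finally have "ln (sup_lik n K (?A e)) + C * real n < ln (sup_lik n K' (?A e))"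
      using large L by linarith
    then have "ln (exp (C * real n) * sup_lik n K (?A e)) < ln (sup_lik n K' (?A e))"
      using pos by (simp add: ln_mult)
    then have "exp (C * real n) * sup_lik n K (?A e) < sup_lik n K' (?A e)"
      using pos by (subst (asm) ln_less_cancel_iff) auto
    then show ?thesis using e by simp
  qed
  have "measure_pmf.prob (map_pmf snd (sbm n K \<theta>)) {A. \<bar>log_lik_ratio n K K' A\<bar> > C * real n}
      = measure_pmf.prob (edge_law n K \<theta>) {e. \<bar>log_lik_ratio n K K' (?A e)\<bar> > C * real n}"
    by (simp add: map_snd_sbm vimage_def)
  also have "\<dots> \<le> measure_pmf.prob (edge_law n K \<theta>) ?bad"
    using bad set_edge_law[of n K \<theta>]
    by (intro measure_pmf.finite_measure_mono_AE) (auto simp: AE_measure_pmf_iff)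
  also have "\<dots> = (\<Sum>e\<in>?bad. pmf (edge_law n K \<theta>) e)"
    using fin by (intro measure_measure_pmf_finite) auto
  also have "\<dots> \<le> (\<Sum>e\<in>?bad. exp (- C * real n) * sup_lik n K' (?A e))"
  proof (rule sum_mono)
    fix e assume e: "e \<in> ?bad"
    then have "exp (C * real n) * pmf (edge_law n K \<theta>) e \<le> exp (C * real n) * sup_lik n K (?A e)"
      using marginal_lik_le_sup[OF \<theta>] by (auto simp: pmf_edge_law[OF \<theta>])
    also have "\<dots> \<le> sup_lik n K' (?A e)" using e by simp
    finally have "exp (- C * real n) * (exp (C * real n) * pmf (edge_law n K \<theta>) e)
        \<le> exp (- C * real n) * sup_lik n K' (?A e)"
      by (intro mult_left_mono) auto
    then show "pmf (edge_law n K \<theta>) e \<le> exp (- C * real n) * sup_lik n K' (?A e)"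
      by (simp flip: mult.assoc exp_add)
  qed
  also have "\<dots> \<le> (\<Sum>e\<in>edge_sets n. exp (- C * real n) * sup_lik n K' (?A e))"
    using fin K by (intro sum_mono2) (auto intro!: mult_nonneg_nonneg less_imp_le[OF sup_lik_pos])
  also have "\<dots> \<le> exp (- C * real n) * (real K' * 4 ^ (K' * K')) ^ n"
    using sum_sup_lik_le[of K' n] K by (simp flip: sum_distrib_left)
  also have "\<dots> = exp (- C * real n) * exp (real n * ln (real K' * 4 ^ (K' * K')))"
    using K by (simp add: exp_of_nat_mult)
  also have "\<dots> = exp (- real n)"
    unfolding C by (simp add: algebra_simps flip: exp_add)
  finally show ?thesis .
qed

section \<open>Boundedness in probability\<close>

theorem theorem2p10:
  fixes K K\<^sub>p :: nat and \<epsilon> :: real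
    and \<pi> :: "nat \<Rightarrow> real" and S :: "nat \<Rightarrow> nat \<Rightarrow> real"
    and \<rho> :: "nat \<Rightarrow> real" and H :: "nat \<Rightarrow> nat \<Rightarrow> nat \<Rightarrow> real"
  assumes K_ge_1: "K \<ge> 1"
    and K_less: "K < K\<^sub>p"
    and H_eq: "\<And>n a b. H n a b = \<rho> n * S a b"
    and S_pos_sym: "\<And>a b. a \<in> {1..K} \<Longrightarrow> b \<in> {1..K} \<Longrightarrow> 0 < S a b \<and> S a b = S b a"
    and true_param: "\<And>n. n \<ge> 1 \<Longrightarrow> (\<pi>, H n) \<in> params K"
    and distinct_columns: "\<And>n a b. n \<ge> 1 \<Longrightarrow> a \<in> {1..K} \<Longrightarrow> b \<in> {1..K} \<Longrightarrow> a \<noteq> b \<Longrightarrow>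
          \<exists>c\<in>{1..K}. H n c a \<noteq> H n c b"
    and density: "\<rho> \<in> \<Omega>(\<lambda>_. 1) \<or>
          (\<rho> \<longlonglongrightarrow> 0 \<and> filterlim (\<lambda>n. real n * \<rho> n / ln (real n)) at_top sequentially)"
    and eps_pos: "\<epsilon> > 0"
    and attained: "(\<lambda>n. measure_pmf.prob (sbm n K (\<pi>, H n))
          {(Z, A). \<exists>z\<^sub>0\<in>large_splittings \<epsilon> n K K\<^sub>p Z. \<forall>z\<in>splittings n K K\<^sub>p Z.
             max_log_complete_lik n K\<^sub>p z A \<le> max_log_complete_lik n K\<^sub>p z\<^sub>0 A}) \<longlonglongrightarrow> 1"
  shows "bounded_in_prob (\<lambda>n. map_pmf snd (sbm n K (\<pi>, H n)))
           (\<lambda>n A. log_lik_ratio n K K\<^sub>p A) (\<lambda>n. real n)"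
  unfolding bounded_in_prob_def
proof (intro allI impI)
  fix \<delta> :: real assume \<delta>: "\<delta> > 0"
  define C where "C = 1 + ln (real K\<^sub>p * 4 ^ (K\<^sub>p * K\<^sub>p))"
  have "1 \<le> real K\<^sub>p * 4 ^ (K\<^sub>p * K\<^sub>p)"
    using K_less mult_mono[of 1 "real K\<^sub>p" 1 "4 ^ (K\<^sub>p * K\<^sub>p)"] by simp
  then have "0 < C" unfolding C_def by (simp add: add_pos_nonneg)
  have "((\<lambda>n. exp (- real n)) \<longlongrightarrow> 0) sequentially"
    by (intro filterlim_compose[OF exp_at_bot] filterlim_compose[OF filterlim_uminus_at_bot_at_top]
        filterlim_real_sequentially)
  then have "\<forall>\<^sub>F n in sequentially. exp (- real n) < \<delta>"
    using \<delta> by (rule order_tendstoD)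
  moreover have "\<forall>\<^sub>F n in sequentially. 1 \<le> n" by (rule eventually_ge_at_top)
  ultimately have "\<forall>\<^sub>F n in sequentially. measure_pmf.prob (map_pmf snd (sbm n K (\<pi>, H n)))
      {A. \<bar>log_lik_ratio n K K\<^sub>p A\<bar> > C * real n} < \<delta>"
  proof eventually_elim
    case (elim n)
    then show ?case
      using log_lik_ratio_tail[OF K_ge_1 K_less true_param[of n] C_def, of n] by linarith
  qed
  with \<open>0 < C\<close> show "\<exists>C>0. \<forall>\<^sub>F n in sequentially.
      measure_pmf.prob (map_pmf snd (sbm n K (\<pi>, H n))) {A. \<bar>log_lik_ratio n K K\<^sub>p A\<bar> > C * real n} < \<delta>"
    by blast
qed

end
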